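(* Let $r>0$ be an integer and $\underline{x}=(x_2,\ldots,x_r)$ a tuple of elements of $\{0,1\}$. Every element of $\Gamma_{\underline{x}}$ is $\Phi$-finite.
   Context: Let $T$ be the infinite rooted regular binary tree whose vertices are the finite words over $\{0,1\}$, with root the empty word, each word $t$ being joined by an edge to the words $0t$ and $1t$. Let $W=\mathrm{Aut}(T)$ be the automorphism group of $T$ (products are compositions, $(uv)(t)=u(v(t))$), with identity element $1$. For $u,v\in W$, let $(u,v)\in W$ be the automorphism fixing the root and given by $t0\mapsto u(t)0$ and $t1\mapsto v(t)1$ for every word $t$. Let $\sigma\in W$ be the involution fixing the root with $t0\mapsto t1$ and $t1\mapsto t0$ for every word $t$. Then $W=(W\times W)\rtimes\langle\sigma\rangle$, so every $w\in W$ can be written uniquely as $(u,v)$ or as $(u,v)\,\sigma$. The first descendants of $w\in W$ are the elements $u$ and $v$ if $w=(u,v)$, respectively the single element $uv$ if $w=(u,v)\,\sigma$. For $n\ge1$, the first descendants of the $n$-th descendants of $w$ are the $(n+1)$-st descendants of $w$. $\mathrm{Desc}(w)$ is the set of all $n$-th descendants of $w$ for all $n\ge1$. An element $w$ is called $\Phi$-finite if $\mathrm{Desc}(w)$ is finite. Let $b_1,\ldots,b_r\in W$ be the elements determined by the recursion relations $b_1=(1,b_r)\,\sigma$; $b_i=(b_{i-1},1)$ for all $2\le i\le r$ with $x_i=0$; $b_i=(1,b_{i-1})$ for all $2\le i\le r$ with $x_i=1$. Let $\Gamma_{\underline{x}}\subset W$ be the subgroup generated by $b_1,\ldots,b_r$.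 *)

theory Defs
  imports "HOL-Algebra.Generated_Groups"
begin

text \<open>
  Vertices of the tree are words over \<open>{0,1}\<close>, written as \<open>bool list\<close> with \<open>False\<close> for \<open>0\<close> and
  \<open>True\<close> for \<open>1\<close>.  The children of \<open>t\<close> are \<open>0t\<close> and \<open>1t\<close>, so the letter at the root is the
  \<^emph>\<open>last\<close> entry of the list.
\<close>

type_synonym word = "bool list"

definition tree_edge :: "word \<Rightarrow> word \<Rightarrow> bool" where
  "tree_edge s t \<longleftrightarrow> (\<exists>a. t = a # s \<or> s = a # t)"

definition tree_auts :: "(word \<Rightarrow> word) set" where
  "tree_auts = {w. bij w \<and> w [] = [] \<and> (\<forall>s t. tree_edge (w s) (w t) \<longleftrightarrow> tree_edge s t)}"

definition W :: "(word \<Rightarrow> word) monoid" where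
  "W = \<lparr>carrier = tree_auts, mult = (\<circ>), one = id\<rparr>"

definition pair :: "(word \<Rightarrow> word) \<Rightarrow> (word \<Rightarrow> word) \<Rightarrow> word \<Rightarrow> word" where
  "pair u v t = (if t = [] then []
                 else (if last t then v (butlast t) else u (butlast t)) @ [last t])"

definition sigma :: "word \<Rightarrow> word" where
  "sigma t = (if t = [] then [] else butlast t @ [\<not> last t])"

definition first_descendants :: "(word \<Rightarrow> word) \<Rightarrow> (word \<Rightarrow> word) set" where
  "first_descendants w = {d. \<exists>u \<in> carrier W. \<exists>v \<in> carrier W.
     (w = pair u v \<and> (d = u \<or> d = v)) \<or>
     (w = pair u v \<otimes>\<^bsub>W\<^esub> sigma \<and> d = u \<otimes>\<^bsub>W\<^esub> v)}"

primrec descendants :: "nat \<Rightarrow> (word \<Rightarrow> word) \<Rightarrow> (word \<Rightarrow> word) set" where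
  "descendants 0 w = {w}"
| "descendants (Suc n) w = (\<Union>d \<in> descendants n w. first_descendants d)"

definition Desc :: "(word \<Rightarrow> word) \<Rightarrow> (word \<Rightarrow> word) set" where
  "Desc w = (\<Union>n \<in> {1..}. descendants n w)"

definition Phi_finite :: "(word \<Rightarrow> word) \<Rightarrow> bool" where
  "Phi_finite w \<longleftrightarrow> finite (Desc w)"

text \<open>
  The tuple \<open>(x\<^sub>2, \<dots>, x\<^sub>r)\<close> is the restriction of \<open>x\<close> to \<open>{2..r}\<close>; other values of \<open>x\<close> are not
  used.  The elements \<open>b\<^sub>1, \<dots>, b\<^sub>r\<close> exist and are unique, by \<open>generators_exist\<close> and
  \<open>generators_unique\<close> below.
\<close>

definition is_generators :: "nat \<Rightarrow> (nat \<Rightarrow> bool) \<Rightarrow> (nat \<Rightarrow> word \<Rightarrow> word) \<Rightarrow> bool" where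
  "is_generators r x b \<longleftrightarrow>
     (\<forall>i \<in> {1..r}. b i \<in> carrier W) \<and>
     b 1 = pair \<one>\<^bsub>W\<^esub> (b r) \<otimes>\<^bsub>W\<^esub> sigma \<and>
     (\<forall>i \<in> {2..r}. b i = (if x i then pair \<one>\<^bsub>W\<^esub> (b (i - 1)) else pair (b (i - 1)) \<one>\<^bsub>W\<^esub>))"

definition Gamma :: "nat \<Rightarrow> (nat \<Rightarrow> word \<Rightarrow> word) \<Rightarrow> (word \<Rightarrow> word) set" where
  "Gamma r b = generate W (b ` {1..r})"


lemma carrier_W [simp]: "carrier W = tree_auts"
  and mult_W [simp]: "u \<otimes>\<^bsub>W\<^esub> v = u \<circ> v"
  and one_W [simp]: "\<one>\<^bsub>W\<^esub> = id"
  by (simp_all add: W_def)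

lemma pair_simps [simp]:
  "pair u v [] = []"
  "pair u v (t @ [False]) = u t @ [False]"
  "pair u v (t @ [True]) = v t @ [True]"
  by (simp_all add: pair_def)

lemma sigma_simps [simp]:
  "sigma [] = []"
  "sigma (t @ [a]) = t @ [\<not> a]"
  by (simp_all add: sigma_def)

lemma tree_autsD:
  assumes "w \<in> tree_auts"
  shows "bij w" "w [] = []" "tree_edge (w s) (w t) \<longleftrightarrow> tree_edge s t"
  using assms unfolding tree_auts_def by blast+

lemma tree_auts_step:
  assumes "w \<in> tree_auts"
  shows "\<exists>c. w (a # t) = c # w t"
proof (induction t arbitrary: a)
  case Nil
  have "tree_edge (w []) (w [a])"
    using tree_autsD(3)[OF assms] by (simp add: tree_edge_def)
  then show ?case by (simp add: tree_edge_def tree_autsD(2)[OF assms])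
next
  case (Cons a' t)
  have inj: "inj w" using tree_autsD(1)[OF assms] by (rule bij_is_inj)
  have "tree_edge (w (a' # t)) (w (a # a' # t))"
    using tree_autsD(3)[OF assms] by (simp add: tree_edge_def)
  then consider c where "w (a # a' # t) = c # w (a' # t)"
    | c where "w (a' # t) = c # w (a # a' # t)"
    by (auto simp: tree_edge_def)
  then show ?case
  proof cases
    case 2
    with Cons.IH[of a'] have "w (a # a' # t) = w t" by auto
    then have "a # a' # t = t" using inj by (meson injD)
    then have "length (a # a' # t) = length t" by (rule arg_cong)
    then show ?thesis by simp
  qed auto
qed

lemma length_of_step:
  assumes "w [] = []" "\<And>a t. \<exists>c. w (a # t) = c # w t"
  shows "length (w t) = length t"
proof (induction t)
  case (Cons a t)
  then show ?case using assms(2)[of a t] by auto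
qed (simp add: assms)

lemma tree_autsI:
  assumes "bij w" "w [] = []" and step: "\<And>a t. \<exists>c. w (a # t) = c # w t"
  shows "w \<in> tree_auts"
proof -
  have "tree_edge s t" if e: "tree_edge (w s) (w t)" for s t
  proof -
    have *: "\<exists>b. p = b # q" if h: "w p = c # w q" for p q c
    proof -
      have "length p = length (w p)" using length_of_step[of w p] assms by simp
      also have "\<dots> = Suc (length (w q))" using h by simp
      also have "\<dots> = Suc (length q)" using length_of_step[of w q] assms by simp
      finally obtain b p' where p: "p = b # p'" by (cases p) auto
      have "w p' = w q" using step[of b p'] h p by auto
      then have "p' = q" using \<open>bij w\<close> by (meson bij_is_inj injD)
      with p show ?thesis by simp
    qed
    show ?thesis using e * unfolding tree_edge_def by metis
  qed
  moreover have "tree_edge (w s) (w t)" if "tree_edge s t" for s t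
    using that step unfolding tree_edge_def by metis
  ultimately show ?thesis using assms(1,2) unfolding tree_auts_def by blast
qed

lemma id_tree_auts: "id \<in> tree_auts"
  by (simp add: tree_auts_def)

lemma comp_tree_auts: "u \<in> tree_auts \<Longrightarrow> v \<in> tree_auts \<Longrightarrow> u \<circ> v \<in> tree_auts"
  by (auto simp: tree_auts_def intro: bij_comp)

lemma inv_tree_auts:
  assumes "u \<in> tree_auts"
  shows "inv_into UNIV u \<in> tree_auts"
proof -
  have b: "bij u" and e: "\<And>s t. tree_edge (u s) (u t) \<longleftrightarrow> tree_edge s t" and n: "u [] = []"
    using tree_autsD[OF assms] by blast+
  have "tree_edge (inv_into UNIV u s) (inv_into UNIV u t) \<longleftrightarrow> tree_edge s t" for s t
    using e[of "inv_into UNIV u s" "inv_into UNIV u t"] b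
    by (simp add: bij_is_surj surj_f_inv_f)
  moreover have "inv_into UNIV u [] = []" using n b by (metis bij_inv_eq_iff)
  ultimately show ?thesis using bij_imp_bij_inv[OF b] unfolding tree_auts_def by blast
qed

lemma group_W: "group W"
proof (rule groupI)
  fix u assume u: "u \<in> carrier W"
  then have "inv_into UNIV u \<circ> u = id"
    by (simp add: bij_is_inj tree_autsD(1))
  then show "\<exists>v \<in> carrier W. v \<otimes>\<^bsub>W\<^esub> u = \<one>\<^bsub>W\<^esub>"
    using inv_tree_auts[of u] u by auto
qed (auto simp: id_tree_auts comp_tree_auts comp_assoc)

lemma pair_tree_auts:
  assumes u: "u \<in> tree_auts" and v: "v \<in> tree_auts"
  shows "pair u v \<in> tree_auts"
proof (rule tree_autsI)
  note uv = tree_autsD(1,2)[OF u] tree_autsD(1,2)[OF v]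
  have 1: "pair (inv_into UNIV u) (inv_into UNIV v) (pair u v t) = t" for t
    using uv by (cases t rule: rev_exhaust) (auto simp: pair_def bij_is_inj)
  have 2: "pair u v (pair (inv_into UNIV u) (inv_into UNIV v) t) = t" for t
    using uv by (cases t rule: rev_exhaust) (auto simp: pair_def bij_is_surj surj_f_inv_f)
  show "bij (pair u v)"
    by (rule o_bij[of "pair (inv_into UNIV u) (inv_into UNIV v)"]) (simp_all add: fun_eq_iff 1 2)
  show "\<exists>c. pair u v (a # t) = c # pair u v t" for a t
  proof (cases t rule: rev_exhaust)
    case Nil
    then show ?thesis using uv by (simp add: pair_def)
  next
    case (snoc s d)
    obtain c1 c2 where "u (a # s) = c1 # u s" "v (a # s) = c2 # v s"
      using tree_auts_step[OF u] tree_auts_step[OF v] by meson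
    with snoc show ?thesis by (simp add: pair_def)
  qed
qed simp

lemma sigma_sigma [simp]: "sigma (sigma t) = t"
  by (cases t rule: rev_exhaust) auto

lemma sigma_tree_auts: "sigma \<in> tree_auts"
proof (rule tree_autsI)
  show "bij sigma" by (rule o_bij[of sigma]) (simp_all add: fun_eq_iff)
  show "\<exists>c. sigma (a # t) = c # sigma t" for a t
    by (cases t rule: rev_exhaust) (auto simp: sigma_def)
qed simp

lemma pair_inject: "pair u v = pair u' v' \<longleftrightarrow> u = u' \<and> v = v'"
proof
  assume e: "pair u v = pair u' v'"
  have "u t = u' t \<and> v t = v' t" for t
    using fun_cong[OF e, of "t @ [False]"] fun_cong[OF e, of "t @ [True]"] by simp
  then show "u = u' \<and> v = v'" by auto
qed simp

lemma pair_sigma_inject: "pair u v \<circ> sigma = pair u' v' \<circ> sigma \<longleftrightarrow> u = u' \<and> v = v'"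
proof
  assume e: "pair u v \<circ> sigma = pair u' v' \<circ> sigma"
  then have "(pair u v \<circ> sigma) (sigma t) = (pair u' v' \<circ> sigma) (sigma t)" for t by simp
  then have "pair u v = pair u' v'" by auto
  then show "u = u' \<and> v = v'" by (simp add: pair_inject)
qed simp

lemma pair_neq_pair_sigma: "pair u v \<noteq> pair u' v' \<circ> sigma"
proof
  assume "pair u v = pair u' v' \<circ> sigma"
  from fun_cong[OF this, of "[False]"] show False by (simp add: pair_def sigma_def)
qed

lemma tree_auts_last:
  assumes w: "w \<in> tree_auts"
  shows "\<exists>s. w (t @ [a]) = s @ w [a]"
proof (induction t)
  case (Cons c t)
  then show ?case using tree_auts_step[OF w, of c "t @ [a]"] by (metis append_Cons)
qed simp

lemma fixing_level_one_eq_pair: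
  assumes w: "w \<in> tree_auts" and l: "w [False] = [False]" "w [True] = [True]"
  shows "\<exists>u \<in> tree_auts. \<exists>v \<in> tree_auts. w = pair u v"
proof -
  define p where "p a t = butlast (w (t @ [a]))" for a t
  have wa: "w [a] = [a]" for a using l by (cases a) auto
  have wp: "w (t @ [a]) = p a t @ [a]" for a t
    using tree_auts_last[OF w, of t a] by (auto simp: wa p_def)
  note bw = tree_autsD(1)[OF w] and w0 = tree_autsD(2)[OF w]
  have "p a \<in> tree_auts" for a
  proof (rule tree_autsI)
    show "p a [] = []" by (simp add: p_def wa)
    show "\<exists>c. p a (d # t) = c # p a t" for d t
    proof -
      obtain c where "w (d # t @ [a]) = c # w (t @ [a])"
        using tree_auts_step[OF w] by blast
      then have "p a (d # t) @ [a] = c # p a t @ [a]"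
        using wp[of "d # t" a] wp[of t a] by simp
      then show ?thesis by simp
    qed
    show "bij (p a)"
    proof (rule bijI)
      show "inj (p a)"
      proof (rule injI)
        fix s t assume "p a s = p a t"
        then have "w (s @ [a]) = w (t @ [a])" by (simp add: wp)
        then show "s = t" using bw by (auto simp: bij_def dest: injD)
      qed
      show "surj (p a)"
      proof (rule surjI)
        fix t
        obtain s where s: "w s = t @ [a]" using bw by (metis bij_pointE)
        then have "s \<noteq> []" using w0 by auto
        then obtain s' b where s': "s = s' @ [b]" by (metis rev_exhaust)
        then have "p b s' = t" "b = a" using s wp[of s' b] by auto
        then have "p a (butlast s) = t" using s' by simp
        moreover have "s = inv_into UNIV w (t @ [a])" using s bw by (metis bij_inv_eq_iff)
        ultimately show "p a (butlast (inv_into UNIV w (t @ [a]))) = t" by simp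
      qed
    qed
  qed
  moreover have "w = pair (p False) (p True)"
  proof
    fix t show "w t = pair (p False) (p True) t"
    proof (cases t rule: rev_exhaust)
      case (snoc s a)
      then show ?thesis by (cases a) (auto simp: wp)
    qed (simp add: w0)
  qed
  ultimately show ?thesis by blast
qed

lemma tree_auts_cases:
  assumes w: "w \<in> tree_auts"
  obtains u v where "u \<in> tree_auts" "v \<in> tree_auts" "w = pair u v"
  | u v where "u \<in> tree_auts" "v \<in> tree_auts" "w = pair u v \<circ> sigma"
proof -
  obtain c d where cd: "w [False] = [c]" "w [True] = [d]"
    using tree_auts_step[OF w, of False "[]"] tree_auts_step[OF w, of True "[]"]
    by (auto simp: tree_autsD(2)[OF w])
  have "w [False] \<noteq> w [True]"
    using bij_is_inj[OF tree_autsD(1)[OF w]] by (auto dest: injD)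
  then have d: "d = (\<not> c)" using cd by auto
  show ?thesis
  proof (cases c)
    case False
    then show ?thesis using fixing_level_one_eq_pair[OF w] cd d that by auto
  next
    case True
    have "(w \<circ> sigma) [False] = [False]" "(w \<circ> sigma) [True] = [True]"
      using True cd d by (simp_all add: sigma_def)
    then obtain u v where uv: "u \<in> tree_auts" "v \<in> tree_auts" "w \<circ> sigma = pair u v"
      using fixing_level_one_eq_pair comp_tree_auts[OF w sigma_tree_auts] by metis
    have "w = (w \<circ> sigma) \<circ> sigma" by auto
    then have "w = pair u v \<circ> sigma" using uv by metis
    with uv that show ?thesis by blast
  qed
qed

lemma first_descendants_pair:
  "u \<in> tree_auts \<Longrightarrow> v \<in> tree_auts \<Longrightarrow> first_descendants (pair u v) = {u, v}"
  by (auto simp: first_descendants_def pair_inject pair_neq_pair_sigma)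

lemma first_descendants_pair_sigma:
  "u \<in> tree_auts \<Longrightarrow> v \<in> tree_auts \<Longrightarrow> first_descendants (pair u v \<circ> sigma) = {u \<circ> v}"
  by (auto simp: first_descendants_def pair_sigma_inject pair_neq_pair_sigma[symmetric])

text \<open>The action of \<open>b\<^sub>i\<close> on reversed words, used to construct the generators.\<close>

fun rev_action :: "nat \<Rightarrow> (nat \<Rightarrow> bool) \<Rightarrow> nat \<Rightarrow> word \<Rightarrow> word" where
  "rev_action r x i [] = []"
| "rev_action r x i (c # t) =
     (if i \<le> 1 then (if c then False # t else True # rev_action r x r t)
      else if c = x i then c # rev_action r x (i - 1) t else c # t)"

lemma rev_action_inj: "rev_action r x i s = rev_action r x i t \<Longrightarrow> s = t"
proof (induction s arbitrary: i t)
  case Nil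
  then show ?case by (cases t) (auto split: if_splits)
next
  case (Cons c s)
  then show ?case by (cases t) (auto split: if_splits)
qed

lemma rev_action_surj: "\<exists>s. rev_action r x i s = t"
proof (induction t arbitrary: i)
  case Nil
  show ?case by (rule exI[of _ "[]"]) simp
next
  case (Cons c t)
  obtain s1 s2 where s: "rev_action r x r s1 = t" "rev_action r x (i - 1) s2 = t"
    using Cons by meson
  show ?case
  proof (cases "i \<le> 1")
    case True
    then show ?thesis using s
      by (intro exI[of _ "if c then False # s1 else True # t"]) auto
  next
    case False
    then show ?thesis using s
      by (intro exI[of _ "if c = x i then c # s2 else c # t"]) auto
  qed
qed

lemma rev_action_snoc: "\<exists>c. rev_action r x i (t @ [a]) = rev_action r x i t @ [c]"
proof (induction t arbitrary: i)
  case (Cons d t)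
  obtain c1 c2 where "rev_action r x r (t @ [a]) = rev_action r x r t @ [c1]"
    "rev_action r x (i - 1) (t @ [a]) = rev_action r x (i - 1) t @ [c2]"
    using Cons by meson
  then show ?case by simp
qed auto

theorem generators_exist:
  "\<exists>b. is_generators r x b"
proof -
  define b where "b i = rev \<circ> rev_action r x i \<circ> rev" for i
  have W: "b i \<in> tree_auts" for i
  proof (rule tree_autsI)
    have "bij (rev_action r x i)"
    proof (rule bijI)
      show "inj (rev_action r x i)" by (rule injI) (rule rev_action_inj)
      show "surj (rev_action r x i)"
        unfolding surj_def using rev_action_surj[of r x i] by metis
    qed
    then show "bij (b i)"
      unfolding b_def by (intro bij_comp) (auto intro!: o_bij[of rev])
    show "\<exists>c. b i (a # t) = c # b i t" for a t
      using rev_action_snoc[of r x i "rev t" a] by (auto simp: b_def)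
  qed (simp add: b_def)
  moreover have "b 1 = pair id (b r) \<circ> sigma"
  proof
    fix t show "b 1 t = (pair id (b r) \<circ> sigma) t"
      by (cases t rule: rev_exhaust) (auto simp: b_def)
  qed
  moreover have "b i = (if x i then pair id (b (i - 1)) else pair (b (i - 1)) id)"
    if "i \<in> {2..r}" for i
  proof
    fix t show "b i t = (if x i then pair id (b (i - 1)) else pair (b (i - 1)) id) t"
    proof (cases t rule: rev_exhaust)
      case (snoc s a)
      then show ?thesis using that by (cases a) (auto simp: b_def)
    qed (auto simp: b_def)
  qed
  ultimately have "is_generators r x b"
    unfolding is_generators_def carrier_W mult_W one_W by blast
  then show ?thesis by blast
qed

theorem generators_unique:
  assumes b: "is_generators r x b" and b': "is_generators r x b'" and i: "i \<in> {1..r}"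
  shows "b i = b' i"
proof
  fix t
  from i show "b i t = b' i t"
  proof (induction t arbitrary: i rule: rev_induct)
    case Nil
    then show ?case using b b' by (simp add: is_generators_def tree_autsD(2))
  next
    case (snoc a t)
    show ?case
    proof (cases "i = 1")
      case True
      have "r \<in> {1..r}" using snoc.prems by auto
      then have "b r t = b' r t" by (rule snoc.IH)
      moreover have "b 1 = pair id (b r) \<circ> sigma" "b' 1 = pair id (b' r) \<circ> sigma"
        using b b' by (simp_all add: is_generators_def)
      ultimately show ?thesis using True by (cases a) simp_all
    next
      case False
      then have i: "i \<in> {2..r}" "i - 1 \<in> {1..r}" using snoc.prems by auto
      then have "b (i - 1) t = b' (i - 1) t" by (intro snoc.IH)
      moreover have "b i = (if x i then pair id (b (i - 1)) else pair (b (i - 1)) id)"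
        "b' i = (if x i then pair id (b' (i - 1)) else pair (b' (i - 1)) id)"
        using b b' i(1) by (auto simp: is_generators_def)
      ultimately show ?thesis by (cases a) auto
    qed
  qed
qed

end

theory Submission
  imports Defs
begin

text \<open>
  Each generator and each inverse of one has the form \<open>(1, t)\<close>, \<open>(t, 1)\<close>, \<open>(1, t) \<sigma>\<close> or
  \<open>(t, 1) \<sigma>\<close>, where \<open>t\<close> is trivial or again a generator or an inverse of one.  Hence a
  product of \<open>n\<close> such elements is \<open>(u, v)\<close> or \<open>(u, v) \<sigma>\<close> where the word lengths of \<open>u\<close> and
  \<open>v\<close> add up to at most \<open>n\<close>, so \<open>u\<close>, \<open>v\<close> and \<open>u v\<close> have word length at most \<open>n\<close>, and there are
  only finitely many elements of bounded word length.
\<close>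

section \<open>Products of a fixed number of factors\<close>

text \<open>Counting factors exactly makes lengths add under composition. Once \<open>id\<close>
  lies in \<open>S\<close>, the same sets also describe the products of at most \<open>n\<close>
  factors.\<close>

primrec products :: "('a \<Rightarrow> 'a) set \<Rightarrow> nat \<Rightarrow> ('a \<Rightarrow> 'a) set" where
  "products S 0 = {id}"
| "products S (Suc n) = (\<Union>s\<in>S. (\<circ>) s ` products S n)"

lemma finite_products: "finite S \<Longrightarrow> finite (products S n)"
  by (induction n) auto

lemma products_comp:
  "u \<in> products S m \<Longrightarrow> v \<in> products S n \<Longrightarrow> u \<circ> v \<in> products S (m + n)"
proof (induction m arbitrary: u)
  case (Suc m)
  then obtain s u' where "s \<in> S" "u' \<in> products S m" "u = s \<circ> u'"
    by auto
  moreover from this have "u' \<circ> v \<in> products S (m + n)"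
    using Suc.IH Suc.prems(2) by blast
  ultimately show ?case
    by (metis UN_I add_Suc comp_assoc image_eqI products.simps(2))
qed simp

lemma products_one: "s \<in> S \<Longrightarrow> s \<in> products S 1"
  by simp

text \<open>A shorter product is padded with factors \<open>id\<close>.\<close>

lemma products_mono:
  assumes "id \<in> S" "m \<le> n"
  shows "products S m \<subseteq> products S n"
proof -
  have "products S k \<subseteq> products S (Suc k)" for k
    using assms(1) by (auto intro!: bexI[of _ id])
  then show ?thesis
    using assms(2) by (rule lift_Suc_mono_le)
qed

lemma products_tree_auts:
  "S \<subseteq> tree_auts \<Longrightarrow> products S n \<subseteq> tree_auts"
  by (induction n) (auto simp: id_tree_auts intro!: comp_tree_auts)

section \<open>Multiplication in terms of \<open>pair\<close> and \<open>sigma\<close>\<close>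

lemma pair_comp_pair: "pair a c \<circ> pair u v = pair (a \<circ> u) (c \<circ> v)"
proof
  fix t show "(pair a c \<circ> pair u v) t = pair (a \<circ> u) (c \<circ> v) t"
    by (cases t rule: rev_exhaust) (auto simp: pair_def)
qed

lemma sigma_comp_pair: "sigma \<circ> pair u v = pair v u \<circ> sigma"
proof
  fix t show "(sigma \<circ> pair u v) t = (pair v u \<circ> sigma) t"
    by (cases t rule: rev_exhaust) (auto simp: pair_def sigma_def)
qed

lemma pair_id_id: "pair id id = id"
proof
  fix t show "pair id id t = id t"
    by (cases t rule: rev_exhaust) (auto simp: pair_def)
qed

lemma sigma_comp_sigma: "sigma \<circ> sigma = id"
  by auto

lemma pair_sigma_comp_pair:
  "(pair a c \<circ> sigma) \<circ> pair u v = pair (a \<circ> v) (c \<circ> u) \<circ> sigma"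
  by (metis comp_assoc sigma_comp_pair pair_comp_pair)

lemma pair_sigma_comp_pair_sigma:
  "(pair a c \<circ> sigma) \<circ> (pair u v \<circ> sigma) = pair (a \<circ> v) (c \<circ> u)"
  by (metis comp_assoc comp_id pair_sigma_comp_pair sigma_comp_sigma)

section \<open>Elements with at most one nontrivial section\<close>

text \<open>All four shapes are allowed so that the family is stable under inversion: the inverse of
  \<open>pair id t \<circ> sigma\<close> has its nontrivial section on the other side.\<close>

definition one_section_in :: "(word \<Rightarrow> word) set \<Rightarrow> (word \<Rightarrow> word) \<Rightarrow> bool" where
  "one_section_in S s \<longleftrightarrow> (\<exists>t\<in>S. s \<in> {pair id t, pair t id, pair id t \<circ> sigma, pair t id \<circ> sigma})"

text \<open>Recording the trivial section as the empty product, of length 0, merges the left and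
  right cases into the single condition \<open>i + j = 1\<close>.\<close>

lemma one_section_inE:
  assumes "one_section_in S s"
  obtains a c i j where "a \<in> products S i" "c \<in> products S j" "i + j = 1"
    "s = pair a c \<or> s = pair a c \<circ> sigma"
proof -
  obtain t where t: "t \<in> S" "s \<in> {pair id t, pair t id, pair id t \<circ> sigma, pair t id \<circ> sigma}"
    using assms unfolding one_section_in_def by blast
  have "id \<in> products S 0" "t \<in> products S 1"
    using t(1) by simp_all
  then show ?thesis
    using t(2) that[of id 0 t 1] that[of t 1 id 0] by fastforce
qed

text \<open>Each new factor on the left contributes one letter in total to the two sections, and
  \<open>sigma\<close> merely exchanges them, so the two lengths always sum to
  \<open>n\<close>.\<close>

lemma products_sections:
  assumes S: "\<And>s. s \<in> S \<Longrightarrow> one_section_in S s"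
  shows "w \<in> products S n \<Longrightarrow> \<exists>k l u v. k + l = n \<and> u \<in> products S k \<and> v \<in> products S l \<and>
    (w = pair u v \<or> w = pair u v \<circ> sigma)"
proof (induction n arbitrary: w)
  case 0
  then show ?case
    by (auto simp: pair_id_id)
next
  case (Suc n)
  then obtain s w' where s: "s \<in> S" and w': "w' \<in> products S n" and w: "w = s \<circ> w'"
    by auto
  obtain k l u v where kl: "k + l = n" and u: "u \<in> products S k" and v: "v \<in> products S l"
    and uv: "w' = pair u v \<or> w' = pair u v \<circ> sigma"
    using Suc.IH[OF w'] by blast
  obtain a c i j where a: "a \<in> products S i" and c: "c \<in> products S j" and ij: "i + j = 1"
    and ac: "s = pair a c \<or> s = pair a c \<circ> sigma"
    using S[OF s] by (rule one_section_inE)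
  from ac show ?case
  proof
    assume "s = pair a c"
    then have "w = pair (a \<circ> u) (c \<circ> v) \<or> w = pair (a \<circ> u) (c \<circ> v) \<circ> sigma"
      using uv unfolding w by (metis comp_assoc pair_comp_pair)
    moreover have "(i + k) + (j + l) = Suc n"
      using ij kl by simp
    ultimately show ?thesis
      using products_comp[OF a u] products_comp[OF c v] by blast
  next
    \<comment> \<open>Moving \<open>sigma\<close> past \<open>w'\<close> swaps its sections, so
      \<open>k\<close> and \<open>l\<close> trade places.\<close>
    assume "s = pair a c \<circ> sigma"
    then have "w = pair (a \<circ> v) (c \<circ> u) \<or> w = pair (a \<circ> v) (c \<circ> u) \<circ> sigma"
      using uv unfolding w by (metis pair_sigma_comp_pair pair_sigma_comp_pair_sigma)
    moreover have "(i + l) + (j + k) = Suc n"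
      using ij kl by simp
    ultimately show ?thesis
      using products_comp[OF a v] products_comp[OF c u] by blast
  qed
qed

lemma first_descendants_products:
  assumes "S \<subseteq> tree_auts" "id \<in> S" "\<And>s. s \<in> S \<Longrightarrow> one_section_in S s" "w \<in> products S n"
  shows "first_descendants w \<subseteq> products S n"
proof -
  obtain k l u v where kl: "k + l = n" and u: "u \<in> products S k" and v: "v \<in> products S l"
    and w: "w = pair u v \<or> w = pair u v \<circ> sigma"
    using products_sections[OF assms(3,4)] by blast
  have "u \<in> tree_auts" "v \<in> tree_auts"
    using products_tree_auts[OF assms(1)] u v by blast+
  then have "first_descendants w \<subseteq> {u, v, u \<circ> v}"
    using w first_descendants_pair first_descendants_pair_sigma by auto
  moreover have "u \<in> products S n" "v \<in> products S n"
    using kl u v products_mono[OF assms(2), of k n] products_mono[OF assms(2), of l n] by auto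
  moreover have "u \<circ> v \<in> products S n"
    using products_comp[OF u v] kl by simp
  ultimately show ?thesis
    by blast
qed

text \<open>The finite set \<open>products S n\<close> is closed under first descendants, hence
  contains all of \<open>Desc w\<close>.\<close>

lemma products_Phi_finite:
  assumes "finite S" "S \<subseteq> tree_auts" "id \<in> S" "\<And>s. s \<in> S \<Longrightarrow> one_section_in S s"
    and "w \<in> products S n"
  shows "Phi_finite w"
proof -
  have "descendants m w \<subseteq> products S n" for m
  proof (induction m)
    case (Suc m)
    then show ?case
      using first_descendants_products[OF assms(2-4)] by fastforce
  qed (simp add: assms(5))
  then have "Desc w \<subseteq> products S n"
    unfolding Desc_def by blast
  then show ?thesis
    unfolding Phi_finite_def using finite_products[OF assms(1)] by (rule finite_subset)
qed

section \<open>Generated subgroups and inverses\<close>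

lemma generate_W_products:
  assumes "w \<in> generate W B" "id \<in> S" "B \<subseteq> S" "\<And>s. s \<in> B \<Longrightarrow> inv\<^bsub>W\<^esub> s \<in> S"
  shows "\<exists>n. w \<in> products S n"
  using assms(1)
proof (induction rule: generate.induct)
  case one
  have "\<one>\<^bsub>W\<^esub> \<in> products S 0"
    unfolding one_W by simp
  then show ?case ..
next
  case (incl h)
  then show ?case
    using assms(3) products_one by blast
next
  case (inv h)
  then show ?case
    using assms(4) products_one by blast
next
  case (eng h1 h2)
  then show ?case
    using products_comp mult_W by metis
qed

lemma inv_W_eq: "u \<in> tree_auts \<Longrightarrow> v \<in> tree_auts \<Longrightarrow> v \<circ> u = id \<Longrightarrow> inv\<^bsub>W\<^esub> u = v"
  using group.inv_equality[OF group_W] by simp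

lemma inv_W_tree_auts: "u \<in> tree_auts \<Longrightarrow> inv\<^bsub>W\<^esub> u \<in> tree_auts"
  using group.inv_closed[OF group_W] by simp

lemma inv_W_comp: "u \<in> tree_auts \<Longrightarrow> inv\<^bsub>W\<^esub> u \<circ> u = id"
  using group.l_inv[OF group_W] by simp

lemma inv_W_pair:
  assumes "u \<in> tree_auts" "v \<in> tree_auts"
  shows "inv\<^bsub>W\<^esub> (pair u v) = pair (inv\<^bsub>W\<^esub> u) (inv\<^bsub>W\<^esub> v)"
  using assms
  by (intro inv_W_eq) (simp_all add: pair_tree_auts inv_W_tree_auts pair_comp_pair inv_W_comp pair_id_id)

text \<open>Inverting puts \<open>sigma\<close> on the left; moving it back to the right swaps the
  inverted sections.\<close>

lemma inv_W_pair_sigma: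
  assumes "u \<in> tree_auts" "v \<in> tree_auts"
  shows "inv\<^bsub>W\<^esub> (pair u v \<circ> sigma) = pair (inv\<^bsub>W\<^esub> v) (inv\<^bsub>W\<^esub> u) \<circ> sigma"
  using assms
  by (intro inv_W_eq)
    (simp_all add: pair_tree_auts sigma_tree_auts comp_tree_auts inv_W_tree_auts
      pair_sigma_comp_pair_sigma inv_W_comp pair_id_id)

lemma inv_W_id: "inv\<^bsub>W\<^esub> id = id"
  by (simp add: inv_W_eq id_tree_auts)

lemma one_section_in_inv:
  assumes "one_section_in S s" "S \<subseteq> tree_auts" "\<And>t. t \<in> S \<Longrightarrow> inv\<^bsub>W\<^esub> t \<in> S'"
  shows "one_section_in S' (inv\<^bsub>W\<^esub> s)"
proof -
  obtain t where t: "t \<in> S" "s \<in> {pair id t, pair t id, pair id t \<circ> sigma, pair t id \<circ> sigma}"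
    using assms(1) unfolding one_section_in_def by blast
  have "t \<in> tree_auts"
    using t(1) assms(2) by blast
  then have "inv\<^bsub>W\<^esub> s \<in> {pair id (inv\<^bsub>W\<^esub> t), pair (inv\<^bsub>W\<^esub> t) id,
      pair id (inv\<^bsub>W\<^esub> t) \<circ> sigma, pair (inv\<^bsub>W\<^esub> t) id \<circ> sigma}"
    using t(2) by (auto simp: inv_W_pair inv_W_pair_sigma inv_W_id id_tree_auts)
  then show ?thesis
    unfolding one_section_in_def using assms(3)[OF t(1)] by blast
qed

lemma one_section_in_mono: "one_section_in S s \<Longrightarrow> S \<subseteq> S' \<Longrightarrow> one_section_in S' s"
  unfolding one_section_in_def by blast

lemma generate_Phi_finite:
  assumes "finite B" "B \<subseteq> tree_auts" "\<And>s. s \<in> B \<Longrightarrow> one_section_in B s"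
    and "w \<in> generate W B"
  shows "Phi_finite w"
proof -
  \<comment> \<open>Inverses make every element of the subgroup a product over \<open>S\<close>;
    \<open>id\<close> permits padding to a common length.\<close>
  define S where "S = insert id (B \<union> (\<lambda>s. inv\<^bsub>W\<^esub> s) ` B)"
  have "S \<subseteq> tree_auts"
    using assms(2) by (auto simp: S_def id_tree_auts inv_W_tree_auts)
  moreover have "one_section_in S s" if "s \<in> S" for s
  proof -
    consider "s = id" | "s \<in> B" | s' where "s' \<in> B" "s = inv\<^bsub>W\<^esub> s'"
      using \<open>s \<in> S\<close> unfolding S_def by blast
    then show ?thesis
    proof cases
      case 1
      \<comment> \<open>Here \<open>t = id\<close> serves as the section, since \<open>id\<close> is
        \<open>pair id id\<close>.\<close>
      then show ?thesis
        unfolding one_section_in_def S_def by (simp add: pair_id_id)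
    next
      case 2
      then show ?thesis
        by (rule one_section_in_mono[OF assms(3)]) (auto simp: S_def)
    next
      case 3
      have "one_section_in S (inv\<^bsub>W\<^esub> s')"
        using assms(3)[OF 3(1)] assms(2) by (rule one_section_in_inv) (simp add: S_def)
      then show ?thesis
        using 3(2) by simp
    qed
  qed
  moreover obtain n where "w \<in> products S n"
    using generate_W_products[OF assms(4), of S] by (auto simp: S_def)
  moreover have "finite S" "id \<in> S"
    using assms(1) by (simp_all add: S_def)
  ultimately show ?thesis
    using products_Phi_finite by blast
qed

section \<open>The recursion for the generators\<close>

text \<open>The nontrivial section lowers the index by one, and the index 1 wraps around to
  \<open>r\<close>, so the sections never leave the set of generators.\<close>

lemma generators_one_section:
  assumes "r > 0" "is_generators r x b" "i \<in> {1..r}"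
  shows "one_section_in (b ` {1..r}) (b i)"
proof (cases "i = 1")
  case True
  have "b 1 = pair id (b r) \<circ> sigma" "b r \<in> b ` {1..r}"
    using assms by (auto simp: is_generators_def)
  then show ?thesis
    unfolding one_section_in_def True by blast
next
  case False
  then have "i \<in> {2..r}" "i - 1 \<in> {1..r}"
    using assms(3) by auto
  then have "i \<in> {2..r}" "b (i - 1) \<in> b ` {1..r}"
    by blast+
  moreover from this have "b i = pair id (b (i - 1)) \<or> b i = pair (b (i - 1)) id"
    using assms(2) by (auto simp: is_generators_def)
  ultimately show ?thesis
    unfolding one_section_in_def by blast
qed

theorem proposition4p9:
  fixes r :: nat and x :: "nat \<Rightarrow> bool" and b :: "nat \<Rightarrow> word \<Rightarrow> word"
  assumes "r > 0"
    and "is_generators r x b"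
    and "w \<in> Gamma r b"
  shows "Phi_finite w"
proof (rule generate_Phi_finite)
  show "b ` {1..r} \<subseteq> tree_auts"
    using assms(2) by (auto simp: is_generators_def)
  show "one_section_in (b ` {1..r}) s" if "s \<in> b ` {1..r}" for s
    using that generators_one_section[OF assms(1,2)] by blast
  show "w \<in> generate W (b ` {1..r})"
    using assms(3) by (simp add: Gamma_def)
qed simp

end
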